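(* Let $n\geqslant 1$, let $\tilde c_1,\dots,\tilde c_n\in\mathbb{R}^d$, let $A_1,\dots,A_n\in S_{++}^d$, and for each $i$ let $H_i\in\mathbb{R}^{d\times d}$ be any matrix with $H_iH_i^\top=A_i$. Then the minimal intersection radius $$r^*=\inf\Big\{r\geqslant 0:\bigcap_{i=1}^nE_r(\tilde c_i,A_i)\neq\emptyset\Big\}$$ is the optimal value of the second-order cone program $$\min_{x\in\mathbb{R}^d,\ r\geqslant 0}\Big\{\,r\ :\ \|H_i^\top(x-\tilde c_i)\|_2\leqslant r,\quad i=1,2,\dots,n\Big\}.$$
   Context: $S_{++}^d$ is the set of real symmetric positive definite $d\times d$ matrices. For $r\geqslant 0$, $E_r(\tilde c,A)=\{x\in\mathbb{R}^d : (x-\tilde c)^\top A(x-\tilde c)\leqslant r^2\}$. $\|\cdot\|_2$ is the Euclidean norm. *)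

theory Defs
  imports "HOL-Analysis.Analysis"
begin

definition sym_pos_def :: "(real ^ 'd ^ 'd) set" where
  "sym_pos_def = {A. transpose A = A \<and> (\<forall>x. x \<noteq> 0 \<longrightarrow> x \<bullet> (A *v x) > 0)}"

definition ellipsoid :: "real \<Rightarrow> real ^ 'd \<Rightarrow> real ^ 'd ^ 'd \<Rightarrow> (real ^ 'd) set" where
  "ellipsoid r c A = {x. (x - c) \<bullet> (A *v (x - c)) \<le> r\<^sup>2}"

text \<open>The infimum is taken in the reals, where the infimum of an empty set is unspecified. For
  \<open>n \<ge> 1\<close> the set below is nonempty (a large enough radius puts any given point in every
  ellipsoid) and bounded below by 0, so this is the true infimum.\<close>

definition min_intersection_radius ::
    "nat \<Rightarrow> (nat \<Rightarrow> real ^ 'd) \<Rightarrow> (nat \<Rightarrow> real ^ 'd ^ 'd) \<Rightarrow> real" where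
  "min_intersection_radius n c A =
     Inf {r. r \<ge> 0 \<and> (\<Inter>i\<in>{1..n}. ellipsoid r (c i) (A i)) \<noteq> {}}"

definition socp_feasible ::
    "nat \<Rightarrow> (nat \<Rightarrow> real ^ 'd) \<Rightarrow> (nat \<Rightarrow> real ^ 'd ^ 'd) \<Rightarrow> ((real ^ 'd) \<times> real) set" where
  "socp_feasible n c H =
     {(x, r). r \<ge> 0 \<and> (\<forall>i\<in>{1..n}. norm (transpose (H i) *v (x - c i)) \<le> r)}"

text \<open>The optimal value of a minimisation problem is read as an attained minimum of the objective
  over the feasible set, not merely an infimum.\<close>

definition is_optimal_value :: "('a \<Rightarrow> real) \<Rightarrow> 'a set \<Rightarrow> real \<Rightarrow> bool" where
  "is_optimal_value f S v \<longleftrightarrow> (\<exists>y\<in>S. f y = v) \<and> (\<forall>y\<in>S. v \<le> f y)"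

end

theory Submission
  imports Defs
begin

text \<open>
  Since the quadratic form of \<open>H H\<^sup>T\<close> at \<open>v\<close> is \<open>\<parallel>H\<^sup>T v\<parallel>\<^sup>2\<close>, the radii admitted by the ellipsoids
  are exactly the objective values of feasible points, so the two infima agree. The infimum is
  attained: positive definiteness of \<open>A\<^sub>1\<close> makes \<open>H\<^sub>1\<^sup>T\<close> injective, hence the points with
  \<open>\<parallel>H\<^sub>1\<^sup>T (x - c\<^sub>1)\<parallel> \<le> r \<le> M\<close> form a bounded set, and sublevel sets of the program are compact.
\<close>

lemma inner_mul_transpose_eq_norm_power2:
  fixes H :: "real ^ 'm ^ 'n"
  shows "v \<bullet> ((H ** transpose H) *v v) = (norm (transpose H *v v))\<^sup>2"
  by (simp flip: matrix_vector_mul_assoc dot_lmul_matrix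
      add: transpose_matrix_vector power2_norm_eq_inner)

text \<open>The sign condition matters: \<open>ellipsoid\<close> sees only the square of
  \<open>r\<close>, so for negative \<open>r\<close> it still contains \<open>c\<close>, while no
  norm is at most \<open>r\<close>.\<close>

lemma mem_ellipsoid_iff_norm_le:
  fixes H :: "real ^ 'd ^ 'd"
  assumes "r \<ge> 0"
  shows "x \<in> ellipsoid r c (H ** transpose H) \<longleftrightarrow> norm (transpose H *v (x - c)) \<le> r"
  using assms
  by (simp add: ellipsoid_def inner_mul_transpose_eq_norm_power2 abs_le_square_iff[symmetric])

text \<open>The quadratic form vanishes on the kernel of \<open>transpose H\<close>, so the kernel
  is trivial; an injective linear map in finite dimension is bounded below.\<close>

lemma sym_pos_def_factor_bounded_below:
  fixes H :: "real ^ 'd ^ 'd"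
  assumes "H ** transpose H \<in> sym_pos_def"
  obtains B where "B > 0" "\<And>v. B * norm v \<le> norm (transpose H *v v)"
proof -
  have "v = 0" if "transpose H *v v = 0" for v
    using assms that inner_mul_transpose_eq_norm_power2[of v H]
    unfolding sym_pos_def_def by force
  then have "inj ((*v) (transpose H))"
    by (simp add: linear_injective_0)
  then show ?thesis
    using linear_inj_bounded_below_pos[of "(*v) (transpose H)"] that
    by (metis matrix_vector_mul_linear mult.commute)
qed

lemma radii_eq_snd_image_socp_feasible:
  assumes "\<And>i. i \<in> {1..n} \<Longrightarrow> H i ** transpose (H i) = A i"
  shows "{r. r \<ge> 0 \<and> (\<Inter>i\<in>{1..n}. ellipsoid r (c i) (A i)) \<noteq> {}}
           = snd ` socp_feasible n c H"
proof -
  have "x \<in> ellipsoid r (c i) (A i) \<longleftrightarrow> norm (transpose (H i) *v (x - c i)) \<le> r"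
    if "i \<in> {1..n}" "r \<ge> 0" for x r i
    using mem_ellipsoid_iff_norm_le[OF that(2), of x "c i" "H i"] assms[OF that(1)] by simp
  then have "r \<ge> 0 \<and> (\<Inter>i\<in>{1..n}. ellipsoid r (c i) (A i)) \<noteq> {} \<longleftrightarrow>
      (\<exists>x. (x, r) \<in> socp_feasible n c H)" for r
    unfolding socp_feasible_def ex_in_conv[symmetric] INT_iff mem_Collect_eq prod.case by blast
  then show ?thesis
    unfolding set_eq_iff snd_eq_Range Range_iff mem_Collect_eq by blast
qed

lemma closed_socp_feasible: "closed (socp_feasible n c H)"
proof -
  have "socp_feasible n c H = {p. 0 \<le> snd p} \<inter>
      (\<Inter>i\<in>{1..n}. {p. norm (transpose (H i) *v (fst p - c i)) \<le> snd p})"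
    by (auto simp: socp_feasible_def)
  also have "closed \<dots>"
    by (intro closed_Int closed_INT ballI closed_Collect_le continuous_intros
        matrix_vector_mult_linear_continuous_on[THEN continuous_on_compose2]) auto
  finally show ?thesis .
qed

lemma socp_feasible_nonempty: "socp_feasible n c H \<noteq> {}"
proof -
  \<comment> \<open>Any point is feasible with a large enough radius; the sum of the nonnegative
    constraint norms dominates each of them.\<close>
  have "(0, \<Sum>i\<in>{1..n}. norm (transpose (H i) *v (0 - c i))) \<in> socp_feasible n c H"
    unfolding socp_feasible_def
    by (auto intro!: sum_nonneg member_le_sum
        [where f = "\<lambda>i. norm (transpose (H i) *v (0 - c i))", simplified])
  then show ?thesis by blast
qed

text \<open>One positive definite constraint suffices: it confines \<open>x\<close> to a ball around
  \<open>c i\<close>, and \<open>r\<close> lies between 0 and \<open>M\<close>.\<close>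

lemma bounded_socp_feasible_sublevel:
  assumes "i \<in> {1..n}" "H i ** transpose (H i) \<in> sym_pos_def"
  shows "bounded (socp_feasible n c H \<inter> {p. snd p \<le> M})"
proof -
  obtain B where B: "B > 0" "\<And>v. B * norm v \<le> norm (transpose (H i) *v v)"
    using sym_pos_def_factor_bounded_below assms(2) by blast
  have "norm (x - c i) \<le> M / B"
    if "(x, r) \<in> socp_feasible n c H" "r \<le> M" for x r
  proof -
    have "B * norm (x - c i) \<le> M"
      using B(2)[of "x - c i"] that assms(1) unfolding socp_feasible_def mem_Collect_eq prod.case
      by (meson order_trans)
    then show ?thesis using B(1) by (simp add: field_simps)
  qed
  then have "socp_feasible n c H \<inter> {p. snd p \<le> M} \<subseteq> cball (c i) (M / B) \<times> {0..M}"
    by (auto simp: dist_norm norm_minus_commute) (auto simp: socp_feasible_def)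
  then show ?thesis
    by (rule bounded_subset[rotated]) (intro bounded_Times bounded_cball bounded_closed_interval)
qed

theorem mainTheorem4:
  fixes n :: nat
    and c :: "nat \<Rightarrow> real ^ 'd"
    and A H :: "nat \<Rightarrow> real ^ 'd ^ 'd"
  assumes "n \<ge> 1"
    and "\<And>i. i \<in> {1..n} \<Longrightarrow> A i \<in> sym_pos_def"
    and "\<And>i. i \<in> {1..n} \<Longrightarrow> H i ** transpose (H i) = A i"
  shows "is_optimal_value (\<lambda>(x, r). r) (socp_feasible n c H) (min_intersection_radius n c A)"
proof -
  let ?S = "socp_feasible n c H"
  obtain p where p: "p \<in> ?S"
    using socp_feasible_nonempty by blast
  \<comment> \<open>Cutting at the value of a feasible point keeps the set nonempty and discards
    only points worse than \<open>p\<close>.\<close>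
  let ?T = "?S \<inter> {q. snd q \<le> snd p}"
  have "bounded ?T"
    using assms by (intro bounded_socp_feasible_sublevel[of 1]) auto
  moreover have "closed ?T"
    by (intro closed_Int closed_socp_feasible closed_Collect_le continuous_intros)
  ultimately have "compact ?T"
    by (simp add: compact_eq_bounded_closed)
  then obtain q where q: "q \<in> ?T" "\<And>y. y \<in> ?T \<Longrightarrow> snd q \<le> snd y"
    using continuous_attains_inf[of ?T snd] p by (force intro: continuous_intros)
  \<comment> \<open>Outside \<open>?T\<close> the value exceeds \<open>snd p\<close>, which is
    already at least \<open>snd q\<close>.\<close>
  have min: "snd q \<le> snd y" if "y \<in> ?S" for y
    using q that by (cases "snd y \<le> snd p") auto
  have "min_intersection_radius n c A = Inf (snd ` ?S)"
    unfolding min_intersection_radius_def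
    by (subst radii_eq_snd_image_socp_feasible) (use assms in auto)
  also have "\<dots> = snd q"
    using q(1) min by (intro cInf_eq_minimum) auto
  finally show ?thesis
    using q(1) min unfolding is_optimal_value_def case_prod_beta by auto
qed

end
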